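(* Let $0<q<\infty$, $1<p<\infty$, and let $T$ be a monotone quasilinear operator on $\mathfrak{M}^+(0,\infty)$. Assume that $w\in\mathcal{W}(0,\infty)$ and that $v\in\mathcal{W}(0,\infty)$ is such that $$\int_0^x v^{1-p'}(t)\,dt<\infty,\qquad x\in(0,\infty).$$ Then the inequality $$\left\| T\left(\int_0^{x} h\right)\right\|_{q,w,(0,\infty)}\le C\,\|h\|_{p,v,(0,\infty)},\qquad h\in\mathfrak{M}^+(0,\infty),$$ holds if and only if the inequality $$\left\|\left(T\left(\left(\int_0^{x} h\right)^{\frac1p}\right)\right)^p\right\|_{q/p,w,(0,\infty)}\le C^p\,\|h\|_{1,\Phi^{1-2p},(0,\infty)},\qquad h\in\mathfrak{M}^+(0,\infty),$$ holds, where $$\Phi(x)=\left(\int_0^x v^{1-p'}(t)\,dt\right)^{\frac{1}{p'+1}},\qquad x\in(0,\infty).$$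
   Context: $\mathfrak{M}(0,\infty)$ is the set of measurable functions on $(0,\infty)$; $\mathfrak{M}^+(0,\infty)$ is the subset of functions non-negative on $(0,\infty)$; $\mathcal{W}(0,\infty)$ is the set of weights, i.e. measurable functions that are positive almost everywhere on $(0,\infty)$. For $p\in(1,\infty)$, $p'=p/(p-1)$. For $s\in(0,\infty)$ and $\omega\in\mathfrak{M}^+(0,\infty)$, $\|f\|_{s,\omega,(0,\infty)}=\left(\int_0^\infty |f(x)|^s\omega(x)\,dx\right)^{1/s}$. A monotone quasilinear operator on $\mathfrak{M}^+(0,\infty)$ is a map $T:\mathfrak{M}^+(0,\infty)\to\mathfrak{M}^+(0,\infty)$ such that: (i) $T(\lambda f)=\lambda Tf$ for all $\lambda\ge0$ and $f\in\mathfrak{M}^+(0,\infty)$; (ii) there is a constant $c>0$, independent of $f,g$, such that $Tf(x)\le c\,Tg(x)$ for almost all $x$ whenever $f(x)\le g(x)$ for almost all $x$; (iii) there is a constant $c>0$, independent of $f,g$, such that $T(f+g)\le c\,(Tf+Tg)$ for all $f,g\in\mathfrak{M}^+(0,\infty)$. In expressions such as $T\left(\int_0^x h\right)$ the operator $T$ acts on the function $x\mapsto\int_0^x h(t)\,dt$, and $T\left(\left(\int_0^x h\right)^{1/p}\right)$ is $T$ applied to $x\mapsto\left(\int_0^x h(t)\,dt\right)^{1/p}$. An inequality "holds" if there is a constant $C>0$, independent of $h$, for which it is valid for all indicated $h$; the constant $C$ may vary from one inequality to another. Conventions: $0\cdot\infty=0$, $\infty/\infty=0$, $0/0=0$. 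*)

theory Defs
  imports "HOL-Analysis.Analysis"
begin

text \<open>
  Members of the class of non-negative measurable functions on the half-line \<open>(0,\<infinity>)\<close> are
  \<open>[0,\<infinity>]\<close>-valued: the value \<open>\<infinity>\<close> has to be allowed since \<open>\<integral>\<^sub>0\<^sup>x h\<close> may be infinite.
  They are represented by total functions on \<^typ>\<open>real\<close>; values outside \<open>(0,\<infinity>)\<close> are irrelevant,
  because measurability, almost-everywhere statements and integrals below refer to
  Lebesgue measure on \<open>(0,\<infinity>)\<close> only.  The product of \<^typ>\<open>ennreal\<close> satisfies \<open>0 * \<infinity> = 0\<close>.
\<close>

abbreviation half_line :: "real measure" where
  "half_line \<equiv> lebesgue_on {0<..}"

definition Mplus :: "(real \<Rightarrow> ennreal) set" where
  "Mplus = borel_measurable half_line"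

definition weights :: "(real \<Rightarrow> ennreal) set" where
  "weights = {w \<in> borel_measurable half_line. AE x in half_line. 0 < w x}"

text \<open>
  Real powers on \<open>[0,\<infinity>]\<close>, extending \<^const>\<open>powr\<close> by the limits at the end points:
  \<open>0\<^sup>a = \<infinity>\<close> and \<open>\<infinity>\<^sup>a = 0\<close> for \<open>a < 0\<close>, \<open>\<infinity>\<^sup>a = \<infinity>\<close> for \<open>a > 0\<close>, and \<open>0\<^sup>0 = \<infinity>\<^sup>0 = 1\<close>.
\<close>

definition ennpowr :: "ennreal \<Rightarrow> real \<Rightarrow> ennreal" where
  "ennpowr x a =
     (if a = 0 then 1
      else if x = 0 then (if a < 0 then \<infinity> else 0)
      else if x = \<infinity> then (if a < 0 then 0 else \<infinity>)
      else ennreal (enn2real x powr a))"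

definition wnorm :: "real \<Rightarrow> (real \<Rightarrow> ennreal) \<Rightarrow> (real \<Rightarrow> ennreal) \<Rightarrow> ennreal" where
  "wnorm s \<omega> f = ennpowr (\<integral>\<^sup>+ x. ennpowr (f x) s * \<omega> x \<partial>half_line) (1 / s)"

definition primitive :: "(real \<Rightarrow> ennreal) \<Rightarrow> real \<Rightarrow> ennreal" where
  "primitive h x = (\<integral>\<^sup>+ t \<in> {0<..<x}. h t \<partial>lebesgue)"

definition conj_exponent :: "real \<Rightarrow> real" where
  "conj_exponent p = p / (p - 1)"

definition Phi :: "real \<Rightarrow> (real \<Rightarrow> ennreal) \<Rightarrow> real \<Rightarrow> ennreal" where
  "Phi p v x =
     ennpowr (primitive (\<lambda>t. ennpowr (v t) (1 - conj_exponent p)) x) (1 / (conj_exponent p + 1))"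

text \<open>
  As usual for measurable functions, the identity and the inequalities between functions in the
  following definition are required to hold almost everywhere on \<open>(0,\<infinity>)\<close>.
\<close>

definition monotone_quasilinear :: "((real \<Rightarrow> ennreal) \<Rightarrow> (real \<Rightarrow> ennreal)) \<Rightarrow> bool" where
  "monotone_quasilinear T \<longleftrightarrow>
     (\<forall>f\<in>Mplus. T f \<in> Mplus) \<and>
     (\<forall>l::real. \<forall>f\<in>Mplus. 0 \<le> l \<longrightarrow>
        (AE x in half_line. T (\<lambda>y. ennreal l * f y) x = ennreal l * T f x)) \<and>
     (\<exists>c::real. 0 < c \<and> (\<forall>f\<in>Mplus. \<forall>g\<in>Mplus.
        (AE x in half_line. f x \<le> g x) \<longrightarrow>
        (AE x in half_line. T f x \<le> ennreal c * T g x))) \<and>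
     (\<exists>c::real. 0 < c \<and> (\<forall>f\<in>Mplus. \<forall>g\<in>Mplus.
        AE x in half_line. T (\<lambda>y. f y + g y) x \<le> ennreal c * (T f x + T g x)))"

end

theory Submission
  imports Defs
begin

text \<open>
  Put \<open>\<sigma> = v\<^bsup>1-p'\<^esup>\<close> and \<open>V(x) = \<integral>\<^sub>0\<^sup>x \<sigma>\<close>.  Since \<open>p' + 1 = (2p - 1) / (p - 1)\<close>, the weight
  \<open>\<Phi>\<^bsup>1-2p\<^esup>\<close> is just \<open>V\<^bsup>1-p\<^esup>\<close>, and the second inequality is the \<open>p\<close>-th power of
  \<open>\<parallel>T((\<integral>\<^sub>0\<^sup>x h)\<^bsup>1/p\<^esup>)\<parallel> \<le> C (\<integral> h V\<^bsup>1-p\<^esup>)\<^bsup>1/p\<^esup>\<close>.  As \<open>T\<close> is monotone up to a constant, the theorem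
  is a statement about the two cones of functions to which \<open>T\<close> is applied: each
  function of one cone lies below a function of the other cone whose norm is not essentially larger.

  \<^item> Every \<open>(\<integral>\<^sub>0\<^sup>x h)\<^bsup>1/p\<^esup>\<close> lies below some \<open>\<integral>\<^sub>0\<^sup>x g\<close> with
    \<open>\<integral> g\<^sup>p v \<le> p' \<integral> h V\<^bsup>1-p\<^esup>\<close>.  For \<open>h\<close> a unit mass at \<open>u\<close> one can spread the value \<open>1\<close> over
    \<open>(0,u)\<close> proportionally to \<open>\<sigma>\<close>, that is take \<open>g = \<sigma> / V(u)\<close> on \<open>(0,u)\<close>.  For general \<open>h\<close> one takes
    \<open>g(t) = \<sigma>(t) (\<integral> h(u) max(V(t), V(u))\<^bsup>-p\<^esup> du)\<^bsup>1/p\<^esup>\<close>; the kernel makes the inner integral at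
    each \<open>t < x\<close> at least \<open>V(x)\<^bsup>-p\<^esup> \<integral>\<^sub>0\<^sup>x h\<close>.  This is \<open>ex_primitive_ge_powr\<close>.

  \<^item> Every \<open>\<integral>\<^sub>0\<^sup>x h\<close> lies below some \<open>(\<integral>\<^sub>0\<^sup>x g)\<^bsup>1/p\<^esup>\<close> with
    \<open>\<integral> g V\<^bsup>1-p\<^esup> \<le> K \<integral> h\<^sup>p v\<close>.  Hoelder's inequality with a suitable power of \<open>V\<close> as an additional
    weight gives \<open>(\<integral>\<^sub>0\<^sup>x h)\<^sup>p \<le> const V(x)\<^sup>b \<integral>\<^sub>0\<^sup>x m\<close>, where \<open>m = h\<^sup>p v V\<^sup>s\<close> and \<open>b + s = p - 1\<close>.
    The right-hand side is a product of two nondecreasing functions, and \<open>g\<close> is, up to constants, what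
    the product rule yields for its derivative: \<open>m V\<^sup>b + V\<^bsup>b-1\<^esup> \<sigma> \<integral>\<^sub>0\<^sup>t m\<close>.  This is
    \<open>ex_powr_primitive_ge\<close>; it contains the weighted Hardy inequality in disguise.

  In both cases the norm is computed by exchanging the order of integration, and only upper bounds for
  \<open>\<integral> f(V) \<sigma>\<close> with nonincreasing \<open>f\<close> are needed.  They say that \<open>V\<close> may be used as the variable of
  integration, \<open>\<integral> f(V) \<sigma> \<le> \<integral>\<^sub>0\<^sup>\<infinity> f(y) dy\<close>, and come from comparing level sets
  (\<open>nn_integral_antimono_of_primitive_le\<close>), so that no differentiation of \<open>V\<close> is involved.
\<close>

section \<open>Real powers on the extended half-line\<close>

lemma ennpowr_0_right [simp]: "ennpowr x 0 = 1"
  by (simp add: ennpowr_def)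

lemma ennpowr_ennreal: "0 < r \<Longrightarrow> ennpowr (ennreal r) a = ennreal (r powr a)"
  by (auto simp: ennpowr_def)

lemma ennpowr_0_left: "ennpowr 0 a = (if a = 0 then 1 else if a < 0 then \<infinity> else 0)"
  by (auto simp: ennpowr_def)

lemma ennpowr_top_left: "ennpowr top a = (if a = 0 then 1 else if a < 0 then 0 else \<infinity>)"
  by (auto simp: ennpowr_def)

lemma ennreal_0_pos_top_cases:
  fixes x :: ennreal
  obtains "x = 0" | "x = top" | r where "0 < r" "x = ennreal r"
  by (cases x) (metis ennreal_0 infinity_ennreal_def le_less)+

lemma ennpowr_ennpowr: "ennpowr (ennpowr x a) b = ennpowr x (a * b)"
  by (cases x rule: ennreal_0_pos_top_cases)
     (auto simp: ennpowr_ennreal ennpowr_0_left ennpowr_top_left powr_powr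
        mult_less_0_iff zero_less_mult_iff ennpowr_def[of 1])

lemma ennpowr_1 [simp]: "ennpowr x 1 = x"
  by (cases x rule: ennreal_0_pos_top_cases)
     (auto simp: ennpowr_ennreal ennpowr_0_left ennpowr_top_left)

lemma ennpowr_mult:
  assumes "0 < a"
  shows "ennpowr (x * y) a = ennpowr x a * ennpowr y a"
proof -
  have "r * s > 0" if "0 < r" "0 < s" for r s :: real using that by simp
  then show ?thesis using assms
    by (cases x rule: ennreal_0_pos_top_cases; cases y rule: ennreal_0_pos_top_cases)
     (auto simp: ennpowr_ennreal ennpowr_0_left ennpowr_top_left powr_mult ennreal_mult_top ennreal_top_mult
        ennreal_mult[symmetric])
qed

text \<open>
  The addition law fails at \<open>0\<close> and \<open>\<infinity>\<close> for exponents of opposite sign, because \<open>0 * \<infinity> = 0\<close> whereas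
  the zeroth power is \<open>1\<close>.
\<close>
lemma ennpowr_add:
  assumes "(0 < x \<and> x < \<infinity>) \<or> (0 \<le> a \<and> 0 \<le> b)"
  shows "ennpowr x (a + b) = ennpowr x a * ennpowr x b"
  using assms
  by (cases x rule: ennreal_0_pos_top_cases)
     (auto simp: ennpowr_ennreal ennpowr_0_left ennpowr_top_left powr_add
        ennreal_mult[symmetric])

lemma ennpowr_mono:
  assumes "0 \<le> a" "x \<le> y"
  shows "ennpowr x a \<le> ennpowr y a"
  using assms
  by (cases x rule: ennreal_0_pos_top_cases; cases y rule: ennreal_0_pos_top_cases)
     (auto simp: ennpowr_ennreal ennpowr_0_left ennpowr_top_left top_unique intro!: ennreal_leI powr_mono2)

lemma ennpowr_antimono:
  assumes "a \<le> 0" "x \<le> y"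
  shows "ennpowr y a \<le> ennpowr x a"
  using assms
  by (cases x rule: ennreal_0_pos_top_cases; cases y rule: ennreal_0_pos_top_cases)
     (auto simp: ennpowr_ennreal ennpowr_0_left ennpowr_top_left top_unique intro!: ennreal_leI powr_mono2')

lemma ennpowr_pos_finite:
  assumes "0 < x" "x < \<infinity>"
  shows "0 < ennpowr x a" "ennpowr x a < \<infinity>"
  using assms
  by (cases x rule: ennreal_0_pos_top_cases; auto simp: ennpowr_ennreal)+

lemma borel_measurable_ennpowr [measurable]: "(\<lambda>x. ennpowr x a) \<in> borel_measurable borel"
  unfolding ennpowr_def by measurable

lemma ennpowr_indicator: "0 < a \<Longrightarrow> ennpowr (indicator A t) a = indicator A t"
  by (auto simp: indicator_def ennpowr_0_left ennpowr_def[of 1])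

section \<open>Primitives on the half-line\<close>

lemma sigma_finite_half_line: "sigma_finite_measure half_line"
proof
  let ?A = "range (\<lambda>n::nat. {0<..<real n})"
  have "{0<..<real n} \<in> sets half_line" for n
    by (auto simp: sets_restrict_space image_iff intro!: bexI[of _ "{0<..<real n}"])
  moreover have "emeasure half_line {0<..<real n} \<noteq> \<infinity>" for n
    by (subst emeasure_restrict_space) auto
  moreover have "\<Union>?A = space half_line"
    using reals_Archimedean2 by (auto simp: space_restrict_space)
  ultimately show "\<exists>A. countable A \<and> A \<subseteq> sets half_line \<and> \<Union>A = space half_line \<and>
         (\<forall>a\<in>A. emeasure half_line a \<noteq> \<infinity>)"
    by (intro exI[of _ ?A]) auto
qed

interpretation half_line: sigma_finite_measure half_line
  by (rule sigma_finite_half_line)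

lemma primitive_eq_half_line:
  "primitive h x = (\<integral>\<^sup>+ t. h t * indicator {..<x} t \<partial>half_line)"
  unfolding primitive_def
  by (subst nn_integral_restrict_space) (auto intro!: nn_integral_cong simp: indicator_def)

lemma borel_measurable_id_half_line [measurable]: "(\<lambda>x. x) \<in> borel_measurable half_line"
  by (intro measurable_restrict_space1 measurable_completion) simp

lemma borel_measurable_primitive [measurable]:
  assumes [measurable]: "h \<in> borel_measurable half_line"
  shows "primitive h \<in> borel_measurable half_line"
proof -
  have "(\<lambda>x. \<integral>\<^sup>+ t. h t * (if t < x then 1 else 0) \<partial>half_line) \<in> borel_measurable half_line"
    by measurable
  also have "(\<lambda>x. \<integral>\<^sup>+ t. h t * (if t < x then 1 else 0) \<partial>half_line) = primitive h"
    by (auto simp: primitive_eq_half_line fun_eq_iff indicator_def intro!: nn_integral_cong)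
  finally show ?thesis .
qed

lemma primitive_mono: "x \<le> y \<Longrightarrow> primitive h x \<le> primitive h y"
  unfolding primitive_def by (rule nn_integral_mono) (auto simp: indicator_def)

lemma AE_half_line_pos: "AE x in half_line. 0 < x"
  by (intro AE_I2) (simp add: space_restrict_space)

lemma AE_half_line_neq: "AE x in half_line. x \<noteq> s"
proof -
  have "AE x in lebesgue. x \<noteq> s"
    by (intro AE_completion AE_lborel_singleton)
  then show ?thesis by (subst AE_restrict_space_iff) auto
qed

lemma Fubini_half_line:
  assumes "case_prod f \<in> borel_measurable (half_line \<Otimes>\<^sub>M half_line)"
  shows "(\<integral>\<^sup>+ y. \<integral>\<^sup>+ x. f x y \<partial>half_line \<partial>half_line) = (\<integral>\<^sup>+ x. \<integral>\<^sup>+ y. f x y \<partial>half_line \<partial>half_line)"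
proof -
  interpret pair_sigma_finite half_line half_line ..
  show ?thesis by (rule Fubini'[OF assms])
qed

section \<open>Hoelder's inequality\<close>

text \<open>
  After division by the two norms, the pointwise Young inequality integrates to
  \<open>1 / p + 1 / p' = 1\<close>.  This normalisation is possible when both integrals are positive and finite; in
  the remaining cases either the product vanishes almost everywhere or the right-hand side is infinite.
\<close>
lemma nn_integral_Hoelder:
  assumes [measurable]: "f \<in> borel_measurable M" "g \<in> borel_measurable M" and "1 < p"
  defines "q \<equiv> conj_exponent p"
  shows "(\<integral>\<^sup>+ x. f x * g x \<partial>M) \<le>
    ennpowr (\<integral>\<^sup>+ x. ennpowr (f x) p \<partial>M) (1 / p) * ennpowr (\<integral>\<^sup>+ x. ennpowr (g x) q \<partial>M) (1 / q)"
    (is "_ \<le> ennpowr ?A _ * ennpowr ?B _")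
proof -
  have q: "0 < q" "1 / p + 1 / q = 1" "1 < q"
    using \<open>1 < p\<close> by (auto simp: q_def conj_exponent_def field_simps)
  have ez: "ennpowr x r = 0 \<longleftrightarrow> x = 0" if "0 < r" for x r
    using that by (cases x rule: ennreal_0_pos_top_cases)
      (auto simp: ennpowr_ennreal ennpowr_0_left ennpowr_top_left)
  have young: "x * y \<le> ennreal (1 / p) * ennpowr x p + ennreal (1 / q) * ennpowr y q" for x y
  proof -
    have "r * s \<le> 1 / p * r powr p + 1 / q * s powr q" if "0 < r" "0 < s" for r s :: real
      using Youngs_inequality[of p q r s] that q \<open>1 < p\<close> by simp
    then show ?thesis using q \<open>1 < p\<close>
      by (cases x rule: ennreal_0_pos_top_cases; cases y rule: ennreal_0_pos_top_cases)
        (auto simp: ennpowr_ennreal ennpowr_0_left ennpowr_top_left ennreal_mult_top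
          ennreal_mult[symmetric] ennreal_plus[symmetric] simp del: ennreal_plus
          intro!: ennreal_leI)
  qed
  consider "?A = 0 \<or> ?B = 0" | "?A \<noteq> 0" "?B \<noteq> 0" "?A = \<infinity> \<or> ?B = \<infinity>"
    | "0 < ?A" "?A < \<infinity>" "0 < ?B" "?B < \<infinity>"
    by (metis infinity_ennreal_def less_top not_gr_zero)
  then show ?thesis
  proof cases
    case 1
    then have "(AE x in M. f x = 0) \<or> (AE x in M. g x = 0)"
      using \<open>1 < p\<close> q by (simp add: nn_integral_0_iff_AE ez)
    then have "AE x in M. f x * g x = 0" by auto
    then have "(\<integral>\<^sup>+ x. f x * g x \<partial>M) = 0" by (subst nn_integral_0_iff_AE) auto
    then show ?thesis by simp
  next
    case 2
    then have "ennpowr ?A (1/p) * ennpowr ?B (1/q) = \<infinity>"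
      using \<open>1 < p\<close> q ez by (auto simp: ennpowr_top_left ennreal_mult_eq_top_iff)
    then show ?thesis by simp
  next
    case 3
    define \<alpha> where "\<alpha> = ennpowr ?A (1/p)"
    define \<beta> where "\<beta> = ennpowr ?B (1/q)"
    have ab: "0 < \<alpha>" "\<alpha> < \<infinity>" "0 < \<beta>" "\<beta> < \<infinity>"
      using 3 by (auto simp: \<alpha>_def \<beta>_def ennpowr_pos_finite[unfolded infinity_ennreal_def])
    have inv: "z * ennpowr z (-1) = 1" if "0 < z" "z < \<infinity>" for z
      using ennpowr_add[of z 1 "-1"] that by simp
    have A: "ennpowr (ennpowr \<alpha> (-1)) p * ?A = 1"
      using 3 \<open>1 < p\<close> inv[of ?A] by (simp add: \<alpha>_def ennpowr_ennpowr mult.commute)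
    have B: "ennpowr (ennpowr \<beta> (-1)) q * ?B = 1"
      using 3 q inv[of ?B] by (simp add: \<beta>_def ennpowr_ennpowr mult.commute)
    have "(\<integral>\<^sup>+ x. (ennpowr \<alpha> (-1) * f x) * (ennpowr \<beta> (-1) * g x) \<partial>M)
      \<le> (\<integral>\<^sup>+ x. ennreal (1 / p) * ennpowr (ennpowr \<alpha> (-1) * f x) p
            + ennreal (1 / q) * ennpowr (ennpowr \<beta> (-1) * g x) q \<partial>M)"
      by (intro nn_integral_mono young)
    also have "\<dots> = ennreal (1 / p) * (ennpowr (ennpowr \<alpha> (-1)) p * ?A)
       + ennreal (1 / q) * (ennpowr (ennpowr \<beta> (-1)) q * ?B)"
      using \<open>1 < p\<close> q by (simp add: nn_integral_add nn_integral_cmult ennpowr_mult)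
    also have "\<dots> = 1" using q(2) \<open>1 < p\<close> q(1)
      by (simp add: A B flip: ennreal_plus)
    finally have "(\<integral>\<^sup>+ x. (ennpowr \<alpha> (-1) * f x) * (ennpowr \<beta> (-1) * g x) \<partial>M) \<le> 1" .
    then have "(\<alpha> * \<beta>) * (\<integral>\<^sup>+ x. (ennpowr \<alpha> (-1) * f x) * (ennpowr \<beta> (-1) * g x) \<partial>M) \<le> (\<alpha> * \<beta>) * 1"
      by (rule mult_left_mono) simp
    also have "(\<alpha> * \<beta>) * (\<integral>\<^sup>+ x. (ennpowr \<alpha> (-1) * f x) * (ennpowr \<beta> (-1) * g x) \<partial>M)
        = (\<integral>\<^sup>+ x. (\<alpha> * ennpowr \<alpha> (-1)) * (\<beta> * ennpowr \<beta> (-1)) * (f x * g x) \<partial>M)"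
      by (subst nn_integral_cmult[symmetric]) (auto intro!: nn_integral_cong simp: mult_ac)
    finally show ?thesis using ab by (simp add: inv \<alpha>_def[symmetric] \<beta>_def[symmetric])
  qed
qed

section \<open>The primitive as the variable of integration\<close>

text \<open>
  An initial piece \<open>E\<close> of the half-line is, up to its right end point, exhausted by intervals \<open>(0,c)\<close>
  with \<open>c \<in> E\<close>, and over such an interval the integral of \<open>\<sigma>\<close> is \<open>primitive \<sigma> c\<close>.
\<close>
lemma nn_integral_le_of_primitive_le:
  assumes [measurable]: "\<sigma> \<in> borel_measurable half_line"
    and L: "\<And>t. t \<in> E \<Longrightarrow> 0 < t \<Longrightarrow> primitive \<sigma> t \<le> L"
    and down: "\<And>s t. t \<in> E \<Longrightarrow> 0 < s \<Longrightarrow> s \<le> t \<Longrightarrow> s \<in> E"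
  shows "(\<integral>\<^sup>+ t. \<sigma> t * indicator E t \<partial>half_line) \<le> L"
proof -
  define P where "P t \<longleftrightarrow> (\<exists>e\<in>E. 0 < e \<and> t < e)" for t
  \<comment> \<open>The end points increase to \<open>Sup E\<close>, or to infinity when \<open>E\<close> is unbounded; the point \<open>Sup E\<close>,
    which may belong to \<open>E\<close>, is a null set.\<close>
  obtain c :: "nat \<Rightarrow> real" where c: "incseq c" "\<And>n. c n \<le> 0 \<or> P (c n)"
    and cover: "AE t in half_line. t \<in> E \<longrightarrow> (\<exists>n. t < c n)"
  proof (cases "bdd_above E \<and> E \<noteq> {}")
    case True
    then have up: "t \<le> Sup E" if "t \<in> E" for t using that by (auto intro: cSup_upper)
    have low: "\<exists>e\<in>E. t < e" if "t < Sup E" for t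
      using that True by (meson less_cSupD)
    show thesis
    proof (rule that[of "\<lambda>n. Sup E - 1 / (Suc n)"])
      show "incseq (\<lambda>n. Sup E - 1 / (Suc n))"
        by (auto simp: incseq_def field_simps)
      show "Sup E - 1 / (Suc n) \<le> 0 \<or> P (Sup E - 1 / (Suc n))" for n
      proof -
        have "Sup E - 1 / (Suc n) < Sup E" by simp
        from low[OF this] obtain e where e: "e \<in> E" "Sup E - 1 / (Suc n) < e" by blast
        then have "0 < e" if "0 < Sup E - 1 / (Suc n)" using that by linarith
        with e show ?thesis unfolding P_def by (meson not_le)
      qed
      show "AE t in half_line. t \<in> E \<longrightarrow> (\<exists>n. t < Sup E - 1 / (Suc n))"
        using AE_half_line_neq[of "Sup E"]
      proof eventually_elim
        case (elim t)
        show ?case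
        proof
          assume "t \<in> E"
          with up elim have "0 < Sup E - t" by force
          then obtain n where "1 / Suc n < Sup E - t"
            by (metis inverse_eq_divide reals_Archimedean)
          then show "\<exists>n. t < Sup E - 1 / (Suc n)" by (intro exI[of _ n]) linarith
        qed
      qed
    qed
  next
    case False
    show thesis
    proof (rule that[of "\<lambda>n. if E = {} then 0 else real n"])
      show "incseq (\<lambda>n. if E = {} then 0 else real n)" by (auto simp: incseq_def)
      show "(if E = {} then 0 else real n) \<le> 0 \<or> P (if E = {} then 0 else real n)" for n
      proof (cases "E = {}")
        case ne: False
        with False obtain e where "e \<in> E" "real n < e" unfolding bdd_above_def by (meson not_le)
        then show ?thesis unfolding P_def using ne by (intro disjI2 bexI[of _ e]) auto
      qed simp
      show "AE t in half_line. t \<in> E \<longrightarrow> (\<exists>n. t < (if E = {} then 0 else real n))"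
        by (auto simp: reals_Archimedean2)
    qed
  qed
  have "(\<integral>\<^sup>+ t. \<sigma> t * indicator E t \<partial>half_line) \<le> (\<integral>\<^sup>+ t. (SUP n. \<sigma> t * indicator {..<c n} t) \<partial>half_line)"
  proof (rule nn_integral_mono_AE)
    show "AE t in half_line. \<sigma> t * indicator E t \<le> (SUP n. \<sigma> t * indicator {..<c n} t)"
      using cover
    proof eventually_elim
      case (elim t)
      show ?case
      proof (cases "t \<in> E")
        case True
        with elim obtain n where "t < c n" by auto
        then show ?thesis using True by (intro SUP_upper2[of n]) auto
      qed simp
    qed
  qed
  also have "\<dots> = (SUP n. \<integral>\<^sup>+ t. \<sigma> t * indicator {..<c n} t \<partial>half_line)"
  proof (rule nn_integral_monotone_convergence_SUP)
    show "incseq (\<lambda>n t. \<sigma> t * indicator {..<c n} t)"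
      using c(1) by (auto simp: incseq_def le_fun_def indicator_def) (meson less_le_trans)
  qed simp
  also have "\<dots> = (SUP n. primitive \<sigma> (c n))" by (simp add: primitive_eq_half_line)
  also have "\<dots> \<le> L"
  proof (rule SUP_least)
    fix n
    show "primitive \<sigma> (c n) \<le> L"
    proof (cases "c n \<le> 0")
      case True
      then show ?thesis by (simp add: primitive_def)
    next
      case False
      with c(2)[of n] obtain e where "e \<in> E" "c n < e" by (auto simp: P_def)
      with False down[of e "c n"] L[of "c n"] show ?thesis by auto
    qed
  qed
  finally show ?thesis .
qed

lemma emeasure_less_ennreal: "emeasure lborel {z::real. 0 < z \<and> ennreal z < e} = e"
proof (cases e)
  case (real r)
  then have "{z::real. 0 < z \<and> ennreal z < e} = {0<..<r}"
    by (auto simp: ennreal_less_iff)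
  with real show ?thesis by simp
next
  case top
  then have "{z::real. 0 < z \<and> ennreal z < e} = {0<..}" by auto
  moreover have "(SUP n. of_nat n) \<le> emeasure lborel {0::real<..}"
  proof (rule SUP_least)
    fix n
    have "of_nat n = emeasure lborel {0<..<real n}" by (simp add: ennreal_of_nat_eq_real_of_nat)
    also have "\<dots> \<le> emeasure lborel {0::real<..}" by (rule emeasure_mono) auto
    finally show "of_nat n \<le> emeasure lborel {0::real<..}" .
  qed
  ultimately show ?thesis using top by (simp add: ennreal_SUP_of_nat_eq_top top_unique)
qed

text \<open>
  Cavalieri's principle: \<open>g(t)\<close> is the length of \<open>{z. 0 < z < g(t)}\<close>, and the order of integration can
  be exchanged.
\<close>
lemma nn_integral_layer_cake:
  assumes "sigma_finite_measure M" and [measurable]: "g \<in> borel_measurable M" "s \<in> borel_measurable M"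
  shows "(\<integral>\<^sup>+ t. g t * s t \<partial>M) =
    (\<integral>\<^sup>+ z. (\<integral>\<^sup>+ t. s t * indicator {t. ennreal z < g t} t \<partial>M) * indicator {0<..} z \<partial>lborel)"
proof -
  interpret M: sigma_finite_measure M by fact
  interpret P: pair_sigma_finite lborel M ..
  have "g t * s t = (\<integral>\<^sup>+ z. s t * (if 0 < z \<and> ennreal z < g t then 1 else 0) \<partial>lborel)" for t
  proof -
    have "(\<integral>\<^sup>+ z. s t * (if 0 < z \<and> ennreal z < g t then 1 else 0) \<partial>lborel)
      = s t * (\<integral>\<^sup>+ z. indicator {z. 0 < z \<and> ennreal z < g t} z \<partial>lborel)"
      by (subst nn_integral_cmult[symmetric]) (auto simp: indicator_def intro!: nn_integral_cong)
    also have "\<dots> = s t * g t"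
      by (subst nn_integral_indicator) (auto simp: emeasure_less_ennreal)
    finally show ?thesis by (simp add: mult.commute)
  qed
  then have "(\<integral>\<^sup>+ t. g t * s t \<partial>M) =
     (\<integral>\<^sup>+ t. (\<integral>\<^sup>+ z. s t * (if 0 < z \<and> ennreal z < g t then 1 else 0) \<partial>lborel) \<partial>M)"
    by simp
  also have "\<dots> = (\<integral>\<^sup>+ z. (\<integral>\<^sup>+ t. s t * (if 0 < z \<and> ennreal z < g t then 1 else 0) \<partial>M) \<partial>lborel)"
    by (rule P.Fubini') measurable
  also have "\<dots> = (\<integral>\<^sup>+ z. (\<integral>\<^sup>+ t. s t * indicator {t. ennreal z < g t} t \<partial>M) * indicator {0<..} z \<partial>lborel)"
    by (intro nn_integral_cong) (auto simp: indicator_def intro!: nn_integral_cong)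
  finally show ?thesis .
qed

text \<open>
  The change of variables \<open>y = V(t)\<close>, \<open>dy = \<sigma>(t) dt\<close>, where \<open>V = primitive \<sigma>\<close>; the right-hand side
  extends over all \<open>y\<close>, even beyond the range of \<open>V\<close>.  By Cavalieri's principle on both sides it is enough to
  compare, for each level \<open>z\<close>, the integral of \<open>\<sigma>\<close> over \<open>{t. z < f(V(t))}\<close> with the length of
  \<open>{y. z < f(y)}\<close>.  The former set is an initial piece of the half-line, and with each \<open>t\<close> in it the latter
  set contains the whole interval \<open>(0,V(t))\<close>.
\<close>
lemma nn_integral_antimono_of_primitive_le:
  assumes [measurable]: "\<sigma> \<in> borel_measurable half_line" "f \<in> borel_measurable borel"
    and anti: "\<And>x y. x \<le> y \<Longrightarrow> f y \<le> f x"
  shows "(\<integral>\<^sup>+ t. f (primitive \<sigma> t) * \<sigma> t \<partial>half_line) \<le> (\<integral>\<^sup>+ y. f (ennreal y) * indicator {0<..} y \<partial>lborel)"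
proof -
  have "(\<integral>\<^sup>+ t. f (primitive \<sigma> t) * \<sigma> t \<partial>half_line) =
    (\<integral>\<^sup>+ z. (\<integral>\<^sup>+ t. \<sigma> t * indicator {t. ennreal z < f (primitive \<sigma> t)} t \<partial>half_line) * indicator {0<..} z \<partial>lborel)"
    by (rule nn_integral_layer_cake[OF sigma_finite_half_line]) measurable
  also have "\<dots> \<le> (\<integral>\<^sup>+ z. (\<integral>\<^sup>+ y. indicator {0<..} y * indicator {y. ennreal z < f (ennreal y)} y \<partial>lborel) * indicator {0<..} z \<partial>lborel)"
  proof (intro nn_integral_mono mult_right_mono)
    fix z :: real
    show "(\<integral>\<^sup>+ t. \<sigma> t * indicator {t. ennreal z < f (primitive \<sigma> t)} t \<partial>half_line)
      \<le> (\<integral>\<^sup>+ y. indicator {0<..} y * indicator {y. ennreal z < f (ennreal y)} y \<partial>lborel)"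
    proof (rule nn_integral_le_of_primitive_le)
      fix t assume t: "t \<in> {t. ennreal z < f (primitive \<sigma> t)}"
      have "primitive \<sigma> t = emeasure lborel {y::real. 0 < y \<and> ennreal y < primitive \<sigma> t}"
        by (simp add: emeasure_less_ennreal)
      also have "\<dots> = (\<integral>\<^sup>+ y. indicator {y::real. 0 < y \<and> ennreal y < primitive \<sigma> t} y \<partial>lborel)"
        by simp
      also have "\<dots> \<le> (\<integral>\<^sup>+ y. indicator {0<..} y * indicator {y. ennreal z < f (ennreal y)} y \<partial>lborel)"
      proof (intro nn_integral_mono)
        fix y :: real
        show "(indicator {y::real. 0 < y \<and> ennreal y < primitive \<sigma> t} y :: ennreal)
            \<le> indicator {0<..} y * indicator {y. ennreal z < f (ennreal y)} y"
          using t anti[of "ennreal y" "primitive \<sigma> t"]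
          by (auto simp: indicator_def dest: order.strict_trans2[OF _ anti[OF less_imp_le]])
      qed
      finally show "primitive \<sigma> t \<le> \<dots>" .
    next
      fix s t :: real
      assume "t \<in> {t. ennreal z < f (primitive \<sigma> t)}" "s \<le> t"
      then show "s \<in> {t. ennreal z < f (primitive \<sigma> t)}"
        using anti[OF primitive_mono[of s t \<sigma>]] by auto
    qed measurable
  qed simp
  also have "\<dots> = (\<integral>\<^sup>+ y. f (ennreal y) * indicator {0<..} y \<partial>lborel)"
    by (rule nn_integral_layer_cake[symmetric]) (auto simp: lborel.sigma_finite_measure_axioms)
  finally show ?thesis .
qed

text \<open>
  In the variable \<open>y = V(t)\<close> the integral is at most \<open>\<integral>\<^sub>0\<^sup>\<infinity> max(y,Y)\<^bsup>-r\<^esup> dy\<close>: the part below \<open>Y\<close>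
  contributes \<open>Y\<^bsup>1-r\<^esup>\<close> and the tail \<open>Y\<^bsup>1-r\<^esup> / (r - 1)\<close>.
\<close>
lemma nn_integral_max_powr_primitive_le:
  assumes [measurable]: "\<sigma> \<in> borel_measurable half_line" and Y: "0 < Y" "Y < \<infinity>" and "1 < r"
  shows "(\<integral>\<^sup>+ t. ennpowr (max (primitive \<sigma> t) Y) (- r) * \<sigma> t \<partial>half_line)
    \<le> ennreal (r / (r - 1)) * ennpowr Y (1 - r)"
proof -
  obtain y where y: "0 < y" "Y = ennreal y"
    using Y by (cases Y rule: ennreal_0_pos_top_cases) auto
  have "(\<integral>\<^sup>+ t. ennpowr (max (primitive \<sigma> t) Y) (- r) * \<sigma> t \<partial>half_line) \<le>
    (\<integral>\<^sup>+ s. ennpowr (max (ennreal s) Y) (- r) * indicator {0<..} s \<partial>lborel)"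
    using \<open>1 < r\<close> by (intro nn_integral_antimono_of_primitive_le ennpowr_antimono max.mono) auto
  also have "\<dots> \<le> (\<integral>\<^sup>+ s. ennreal (y powr (- r)) * indicator {0..y} s
                   + ennreal (s powr (- r)) * indicator {y..} s \<partial>lborel)"
    using y by (intro nn_integral_mono) (auto simp: indicator_def max_def ennpowr_ennreal)
  also have "\<dots> = ennreal (y powr (- r)) * ennreal y + ennreal (- (y powr (- r + 1)) / (- r + 1))"
    using y \<open>1 < r\<close> has_integral_powr_to_inf[of "- r" y]
    by (subst nn_integral_add) (auto simp: nn_integral_cmult nn_integral_has_integral_lebesgue')
  also have "\<dots> = ennreal (r / (r - 1)) * ennpowr Y (1 - r)"
  proof -
    have "y powr (- r) * y = y powr (1 - r)"
      using y powr_add[of y "- r" 1] by (simp add: add.commute)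
    then have "y powr (- r) * y + - (y powr (- r + 1)) / (- r + 1) = r / (r - 1) * y powr (1 - r)"
      using \<open>1 < r\<close> by (simp add: field_simps)
    moreover have "0 \<le> - (y powr (- r + 1)) / (- r + 1)"
      using \<open>1 < r\<close> by (intro divide_nonpos_nonpos) auto
    ultimately show ?thesis using y \<open>1 < r\<close>
      by (simp add: ennpowr_ennreal flip: ennreal_mult' ennreal_plus)
  qed
  finally show ?thesis .
qed

lemma primitive_powr_primitive_le:
  assumes [measurable]: "\<sigma> \<in> borel_measurable half_line" and fin: "primitive \<sigma> x < \<infinity>"
    and a: "0 < a" "a < 1"
  shows "primitive (\<lambda>t. ennpowr (primitive \<sigma> t) (- a) * \<sigma> t) x
    \<le> ennreal (1 / (1 - a)) * ennpowr (primitive \<sigma> x) (1 - a)"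
proof -
  define Y where "Y = primitive \<sigma> x"
  \<comment> \<open>Cutting off above \<open>V(x)\<close> restricts the integral to \<open>(0,x)\<close> and keeps the integrand nonincreasing in \<open>V\<close>.\<close>
  define f where "f z = (if z \<le> Y then ennpowr z (- a) else 0)" for z
  have [measurable]: "f \<in> borel_measurable borel" unfolding f_def by measurable
  have f: "f z' \<le> f z" if "z \<le> z'" for z z'
    using that a by (auto simp: f_def intro!: ennpowr_antimono)
  obtain y where y: "0 \<le> y" "Y = ennreal y"
    using fin by (cases Y) (auto simp: Y_def)
  have "primitive (\<lambda>t. ennpowr (primitive \<sigma> t) (- a) * \<sigma> t) x
      \<le> (\<integral>\<^sup>+ t. f (primitive \<sigma> t) * \<sigma> t \<partial>half_line)"
    unfolding primitive_eq_half_line[of _ x]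
    using primitive_mono[of _ x \<sigma>]
    by (intro nn_integral_mono) (auto simp: f_def Y_def indicator_def)
  also have "\<dots> \<le> (\<integral>\<^sup>+ s. f (ennreal s) * indicator {0<..} s \<partial>lborel)"
    by (rule nn_integral_antimono_of_primitive_le[OF _ _ f]) auto
  also have "\<dots> \<le> (\<integral>\<^sup>+ s. ennreal (s powr (- a)) * indicator {0..y} s \<partial>lborel)"
    using y by (intro nn_integral_mono) (auto simp: indicator_def f_def ennpowr_ennreal)
  also have "\<dots> = ennreal (y powr (- a + 1) / (- a + 1))"
    using has_integral_powr_from_0[of "- a" y] a y
    by (intro nn_integral_has_integral_lebesgue') auto
  also have "\<dots> = ennreal (1 / (1 - a)) * ennpowr Y (1 - a)"
  proof (cases "y = 0")
    case True
    then show ?thesis using y a by (simp add: ennpowr_0_left)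
  next
    case False
    then show ?thesis using y a
      by (simp add: ennpowr_ennreal flip: ennreal_mult')
  qed
  finally show ?thesis by (simp add: Y_def)
qed

text \<open>
  Apply the change of variables to the indicator of \<open>{0}\<close>, which is nonincreasing on \<open>[0,\<infinity>]\<close>.
\<close>
lemma AE_primitive_eq_0:
  assumes [measurable]: "\<sigma> \<in> borel_measurable half_line"
  shows "AE t in half_line. primitive \<sigma> t = 0 \<longrightarrow> \<sigma> t = 0"
proof -
  define f :: "ennreal \<Rightarrow> ennreal" where "f z = (if z = 0 then 1 else 0)" for z
  have [measurable]: "f \<in> borel_measurable borel" unfolding f_def by measurable
  have "(\<integral>\<^sup>+ t. f (primitive \<sigma> t) * \<sigma> t \<partial>half_line) \<le> (\<integral>\<^sup>+ s. f (ennreal s) * indicator {0<..} s \<partial>lborel)"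
    by (rule nn_integral_antimono_of_primitive_le) (auto simp: f_def)
  also have "\<dots> = 0"
    by (subst nn_integral_0_iff_AE) (auto simp: f_def indicator_def)
  finally have "AE t in half_line. f (primitive \<sigma> t) * \<sigma> t = 0"
    by (simp add: nn_integral_0_iff_AE)
  then show ?thesis by eventually_elim (auto simp: f_def split: if_splits)
qed

section \<open>Dominating the root of a primitive by a primitive\<close>

text \<open>
  The function \<open>G(t) = \<integral> h(u) max(V(t),V(u))\<^bsup>-p\<^esup> du\<close> is bounded below on \<open>(0,x)\<close> by
  \<open>c = V(x)\<^bsup>-p\<^esup> \<integral>\<^sub>0\<^sup>x h\<close>, so \<open>\<integral>\<^sub>0\<^sup>x \<sigma> G\<^bsup>1/p\<^esup> \<ge> V(x) c\<^bsup>1/p\<^esup> = (\<integral>\<^sub>0\<^sup>x h)\<^bsup>1/p\<^esup>\<close>; and its integral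
  against \<open>\<sigma>\<close> is computed by integrating the kernel in \<open>t\<close> first.  Where \<open>V\<close> vanishes the weight
  \<open>V\<^bsup>1-p\<^esup>\<close> is infinite, and finiteness of the right-hand norm forces \<open>h = 0\<close> there.
\<close>
lemma ex_primitive_ge_powr:
  assumes [measurable]: "\<sigma> \<in> borel_measurable half_line" "h \<in> borel_measurable half_line"
    and fin: "\<And>x. 0 < x \<Longrightarrow> primitive \<sigma> x < \<infinity>" and "1 < p"
    and finite_norm: "(\<integral>\<^sup>+ t. h t * ennpowr (primitive \<sigma> t) (1 - p) \<partial>half_line) < \<infinity>"
  obtains G where "G \<in> borel_measurable half_line"
    and "\<And>x. 0 < x \<Longrightarrow>
      ennpowr (primitive h x) (1 / p) \<le> primitive (\<lambda>t. \<sigma> t * ennpowr (G t) (1 / p)) x"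
    and "(\<integral>\<^sup>+ t. \<sigma> t * G t \<partial>half_line) \<le>
      ennreal (p / (p - 1)) * (\<integral>\<^sup>+ t. h t * ennpowr (primitive \<sigma> t) (1 - p) \<partial>half_line)"
proof
  define V where "V = primitive \<sigma>"
  have [measurable]: "V \<in> borel_measurable half_line" unfolding V_def by measurable
  define G where "G t = (\<integral>\<^sup>+ u. h u * ennpowr (max (V t) (V u)) (- p) \<partial>half_line)" for t
  show G [measurable]: "G \<in> borel_measurable half_line" unfolding G_def by measurable
  have vanish: "AE t in half_line. V t = 0 \<longrightarrow> h t = 0"
  proof -
    have "AE t in half_line. h t * ennpowr (V t) (1 - p) \<noteq> \<infinity>"
      using finite_norm by (intro nn_integral_noteq_infinite) (auto simp: V_def)
    then show ?thesis
      by eventually_elim (use \<open>1 < p\<close> in \<open>auto simp: ennpowr_0_left ennreal_mult_eq_top_iff\<close>)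
  qed
  show "ennpowr (primitive h x) (1 / p) \<le> primitive (\<lambda>t. \<sigma> t * ennpowr (G t) (1 / p)) x"
    if "0 < x" for x
  proof (cases "V x = 0")
    case True
    have "primitive h x = 0"
      unfolding primitive_eq_half_line
    proof (subst nn_integral_0_iff_AE)
      show "AE t in half_line. h t * indicator {..<x} t = 0"
        using vanish
      proof eventually_elim
        case (elim t)
        then show ?case using primitive_mono[of t x \<sigma>] True by (auto simp: indicator_def V_def)
      qed
    qed measurable
    then show ?thesis using \<open>1 < p\<close> by (simp add: ennpowr_0_left)
  next
    case False
    then have Vx: "0 < V x" "V x < \<infinity>" using fin[OF \<open>0 < x\<close>] by (auto simp: V_def zero_less_iff_neq_zero)
    let ?c = "primitive h x * ennpowr (V x) (- p)"
    have G_ge: "?c \<le> G t" if "t < x" for t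
    proof -
      have "?c = (\<integral>\<^sup>+ u. h u * indicator {..<x} u * ennpowr (V x) (- p) \<partial>half_line)"
        by (simp add: primitive_eq_half_line nn_integral_multc)
      also have "\<dots> \<le> G t" unfolding G_def
      proof (rule nn_integral_mono)
        fix u
        have "ennpowr (V x) (- p) \<le> ennpowr (max (V t) (V u)) (- p)" if "u < x"
          using that \<open>t < x\<close> \<open>1 < p\<close> primitive_mono[of _ x \<sigma>]
          by (intro ennpowr_antimono) (auto simp: V_def)
        then show "h u * indicator {..<x} u * ennpowr (V x) (- p) \<le> h u * ennpowr (max (V t) (V u)) (- p)"
          by (auto simp: indicator_def intro!: mult_left_mono)
      qed
      finally show ?thesis .
    qed
    have "ennpowr (primitive h x) (1 / p) = V x * ennpowr ?c (1 / p)"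
    proof -
      have "V x * ennpowr (V x) (- 1) = 1"
        using ennpowr_add[of "V x" 1 "- 1"] Vx by simp
      moreover have "ennpowr ?c (1 / p) = ennpowr (primitive h x) (1 / p) * ennpowr (V x) (- 1)"
        using \<open>1 < p\<close> by (simp add: ennpowr_mult ennpowr_ennpowr)
      ultimately show ?thesis by (metis mult.commute mult.left_commute mult.right_neutral)
    qed
    also have "\<dots> = (\<integral>\<^sup>+ t. \<sigma> t * indicator {..<x} t * ennpowr ?c (1 / p) \<partial>half_line)"
      by (simp add: V_def primitive_eq_half_line[of \<sigma>] nn_integral_multc)
    also have "\<dots> \<le> (\<integral>\<^sup>+ t. \<sigma> t * ennpowr (G t) (1 / p) * indicator {..<x} t \<partial>half_line)"
      using G_ge \<open>1 < p\<close>
      by (intro nn_integral_mono) (auto simp: indicator_def intro!: mult_left_mono ennpowr_mono)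
    finally show ?thesis by (simp add: primitive_eq_half_line)
  qed
  have "(\<integral>\<^sup>+ t. \<sigma> t * G t \<partial>half_line)
     = (\<integral>\<^sup>+ t. \<integral>\<^sup>+ u. h u * (ennpowr (max (V t) (V u)) (- p) * \<sigma> t) \<partial>half_line \<partial>half_line)"
    unfolding G_def by (subst nn_integral_cmult[symmetric]) (auto simp: mult_ac)
  also have "\<dots> = (\<integral>\<^sup>+ u. \<integral>\<^sup>+ t. h u * (ennpowr (max (V t) (V u)) (- p) * \<sigma> t) \<partial>half_line \<partial>half_line)"
    by (rule Fubini_half_line) measurable
  also have "\<dots> \<le> (\<integral>\<^sup>+ u. ennreal (p / (p - 1)) * (h u * ennpowr (V u) (1 - p)) \<partial>half_line)"
  proof (rule nn_integral_mono_AE)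
    show "AE u in half_line. (\<integral>\<^sup>+ t. h u * (ennpowr (max (V t) (V u)) (- p) * \<sigma> t) \<partial>half_line)
        \<le> ennreal (p / (p - 1)) * (h u * ennpowr (V u) (1 - p))"
      using vanish AE_half_line_pos
    proof eventually_elim
      case (elim u)
      show ?case
      proof (cases "V u = 0")
        case True
        with elim show ?thesis by simp
      next
        case False
        then have "0 < V u" "V u < \<infinity>"
          using fin[OF elim(2)] by (auto simp: V_def zero_less_iff_neq_zero)
        then have "(\<integral>\<^sup>+ t. ennpowr (max (V t) (V u)) (- p) * \<sigma> t \<partial>half_line)
            \<le> ennreal (p / (p - 1)) * ennpowr (V u) (1 - p)"
          unfolding V_def using \<open>1 < p\<close> by (intro nn_integral_max_powr_primitive_le) auto
        from mult_left_mono[OF this, of "h u"] show ?thesis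
          by (subst nn_integral_cmult) (auto simp: mult_ac)
      qed
    qed
  qed
  also have "\<dots> = ennreal (p / (p - 1)) * (\<integral>\<^sup>+ u. h u * ennpowr (V u) (1 - p) \<partial>half_line)"
    by (rule nn_integral_cmult) measurable
  finally show "(\<integral>\<^sup>+ t. \<sigma> t * G t \<partial>half_line) \<le>
      ennreal (p / (p - 1)) * (\<integral>\<^sup>+ t. h t * ennpowr (primitive \<sigma> t) (1 - p) \<partial>half_line)"
    by (simp add: V_def)
qed

section \<open>Dominating a primitive by the root of a primitive\<close>

text \<open>
  The product rule for \<open>V\<^sup>b \<integral>\<^sub>0\<^sup>x m\<close>, as the one-sided estimate that needs no differentiation:
  the factor \<open>b \<le> 1\<close> in front of \<open>V\<^bsup>b-1\<^esup> \<sigma>\<close> is replaced by \<open>1\<close>.  For \<open>b = 1\<close> it is Fubini's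
  theorem, applied to \<open>V(x) = V(u) + \<integral>\<^sub>u\<^sup>x \<sigma>\<close>.  For \<open>b \<le> 1\<close> write \<open>V(x)\<^sup>b = V(x)\<^bsup>b-1\<^esup> V(x)\<close> and use that
  \<open>V(x)\<^bsup>b-1\<^esup> \<le> V(t)\<^bsup>b-1\<^esup>\<close> for \<open>t < x\<close>.
\<close>
lemma powr_primitive_mult_primitive_le:
  assumes [measurable]: "\<sigma> \<in> borel_measurable half_line" "m \<in> borel_measurable half_line"
    and fin: "primitive \<sigma> x < \<infinity>" and b: "0 < b" "b \<le> 1"
  shows "ennpowr (primitive \<sigma> x) b * primitive m x \<le>
    primitive (\<lambda>t. m t * ennpowr (primitive \<sigma> t) b + ennpowr (primitive \<sigma> t) (b - 1) * \<sigma> t * primitive m t) x"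
proof (cases "primitive \<sigma> x = 0")
  case False
  define V where "V = primitive \<sigma>"
  have [measurable]: "V \<in> borel_measurable half_line" unfolding V_def by measurable
  have Vx: "0 < V x" "V x < \<infinity>" using fin False by (auto simp: V_def zero_less_iff_neq_zero)
  let ?d = "ennpowr (V x) (b - 1)"
  have d: "?d \<le> ennpowr (V t) (b - 1)" if "t < x" for t
    using that b primitive_mono[of t x \<sigma>] by (auto simp: V_def intro!: ennpowr_antimono)
  have split: "V x = V u + (\<integral>\<^sup>+ t. (if u < t \<and> t < x then \<sigma> t else 0) \<partial>half_line)" if "u < x" for u
  proof -
    have "V x = (\<integral>\<^sup>+ t. \<sigma> t * indicator {..<u} t + (if u < t \<and> t < x then \<sigma> t else 0) \<partial>half_line)"
      unfolding V_def primitive_eq_half_line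
    proof (rule nn_integral_cong_AE)
      show "AE t in half_line. \<sigma> t * indicator {..<x} t
          = \<sigma> t * indicator {..<u} t + (if u < t \<and> t < x then \<sigma> t else 0)"
        using AE_half_line_neq[of u] by eventually_elim (use \<open>u < x\<close> in \<open>auto simp: indicator_def\<close>)
    qed
    also have "\<dots> = V u + (\<integral>\<^sup>+ t. (if u < t \<and> t < x then \<sigma> t else 0) \<partial>half_line)"
      unfolding V_def primitive_eq_half_line by (subst nn_integral_add) auto
    finally show ?thesis .
  qed
  have "ennpowr (V x) b * primitive m x = ?d * (\<integral>\<^sup>+ u. V x * (m u * indicator {..<x} u) \<partial>half_line)"
    using ennpowr_add[of "V x" "b - 1" 1] Vx
    by (simp add: primitive_eq_half_line nn_integral_cmult mult.assoc)
  also have "(\<integral>\<^sup>+ u. V x * (m u * indicator {..<x} u) \<partial>half_line) =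
    (\<integral>\<^sup>+ u. V u * m u * indicator {..<x} u
       + (\<integral>\<^sup>+ t. (if u < t \<and> t < x then \<sigma> t * m u else 0) \<partial>half_line) \<partial>half_line)"
  proof (rule nn_integral_cong)
    fix u
    show "V x * (m u * indicator {..<x} u) = V u * m u * indicator {..<x} u
       + (\<integral>\<^sup>+ t. (if u < t \<and> t < x then \<sigma> t * m u else 0) \<partial>half_line)"
    proof (cases "u < x")
      case True
      have "(\<integral>\<^sup>+ t. (if u < t \<and> t < x then \<sigma> t * m u else 0) \<partial>half_line)
        = (\<integral>\<^sup>+ t. (if u < t \<and> t < x then \<sigma> t else 0) * m u \<partial>half_line)"
        by (intro nn_integral_cong) auto
      also have "\<dots> = (\<integral>\<^sup>+ t. (if u < t \<and> t < x then \<sigma> t else 0) \<partial>half_line) * m u"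
        by (rule nn_integral_multc) measurable
      finally show ?thesis using True by (simp add: split[OF True] distrib_right)
    next
      case False
      then have "(\<lambda>t. if u < t \<and> t < x then \<sigma> t * m u else 0) = (\<lambda>t. 0)" by (auto simp: fun_eq_iff)
      then show ?thesis using False by simp
    qed
  qed
  also have "\<dots> = (\<integral>\<^sup>+ u. V u * m u * indicator {..<x} u \<partial>half_line)
     + (\<integral>\<^sup>+ u. \<integral>\<^sup>+ t. (if u < t \<and> t < x then \<sigma> t * m u else 0) \<partial>half_line \<partial>half_line)"
    by (rule nn_integral_add) measurable
  also have "(\<integral>\<^sup>+ u. \<integral>\<^sup>+ t. (if u < t \<and> t < x then \<sigma> t * m u else 0) \<partial>half_line \<partial>half_line)
     = (\<integral>\<^sup>+ t. \<integral>\<^sup>+ u. (if u < t \<and> t < x then \<sigma> t * m u else 0) \<partial>half_line \<partial>half_line)"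
    by (rule Fubini_half_line) measurable
  also have "\<dots> = (\<integral>\<^sup>+ t. \<sigma> t * primitive m t * indicator {..<x} t \<partial>half_line)"
  proof (rule nn_integral_cong)
    fix t
    have "(\<integral>\<^sup>+ u. (if u < t \<and> t < x then \<sigma> t * m u else 0) \<partial>half_line)
      = (\<integral>\<^sup>+ u. (\<sigma> t * indicator {..<x} t) * (m u * indicator {..<t} u) \<partial>half_line)"
      by (intro nn_integral_cong) (auto simp: indicator_def)
    also have "\<dots> = \<sigma> t * indicator {..<x} t * primitive m t"
      unfolding primitive_eq_half_line by (rule nn_integral_cmult) measurable
    finally show "(\<integral>\<^sup>+ u. (if u < t \<and> t < x then \<sigma> t * m u else 0) \<partial>half_line)
      = \<sigma> t * primitive m t * indicator {..<x} t" by (simp add: mult_ac)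
  qed
  also have "(\<integral>\<^sup>+ u. V u * m u * indicator {..<x} u \<partial>half_line) + \<dots>
     = (\<integral>\<^sup>+ t. (V t * m t + \<sigma> t * primitive m t) * indicator {..<x} t \<partial>half_line)"
    by (subst nn_integral_add[symmetric]) (auto simp: distrib_right)
  also have "?d * \<dots> = (\<integral>\<^sup>+ t. ?d * ((V t * m t + \<sigma> t * primitive m t) * indicator {..<x} t) \<partial>half_line)"
    by (rule nn_integral_cmult[symmetric]) measurable
  also have "\<dots> \<le> (\<integral>\<^sup>+ t. (m t * ennpowr (V t) b + ennpowr (V t) (b - 1) * \<sigma> t * primitive m t)
      * indicator {..<x} t \<partial>half_line)"
  proof (rule nn_integral_mono)
    fix t
    have "?d * V t \<le> ennpowr (V t) b" if "t < x"
    proof (cases "V t = 0")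
      case True then show ?thesis by simp
    next
      case False
      have "V t < \<infinity>" using primitive_mono[of t x \<sigma>] \<open>t < x\<close> Vx by (auto simp: V_def)
      then have "ennpowr (V t) b = ennpowr (V t) (b - 1) * V t"
        using False ennpowr_add[of "V t" "b - 1" 1] by (simp add: zero_less_iff_neq_zero)
      then show ?thesis using d[OF that] by (simp add: mult_right_mono)
    qed
    then have "?d * (V t * m t + \<sigma> t * primitive m t)
        \<le> m t * ennpowr (V t) b + ennpowr (V t) (b - 1) * \<sigma> t * primitive m t" if "t < x"
      using that d[OF that] unfolding distrib_left mult.assoc[symmetric]
      by (intro add_mono mult_right_mono) (auto simp: mult.commute[of "m t"] intro!: mult_right_mono)
    then show "?d * ((V t * m t + \<sigma> t * primitive m t) * indicator {..<x} t) \<le>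
      (m t * ennpowr (V t) b + ennpowr (V t) (b - 1) * \<sigma> t * primitive m t) * indicator {..<x} t"
      by (simp add: indicator_def)
  qed
  finally show ?thesis unfolding primitive_eq_half_line[of _ x] V_def by simp
qed (use b in \<open>simp add: ennpowr_0_left\<close>)

text \<open>
  The function in parentheses is the majorant from the product rule for \<open>V\<^sup>b \<integral>\<^sub>0\<^sup>x m\<close>.  Multiplied by
  \<open>V\<^bsup>-s-b\<^esup>\<close>, its first summand becomes \<open>k\<close>.  The second becomes \<open>V\<^bsup>-1-s\<^esup> \<sigma> \<integral>\<^sub>0\<^sup>t m\<close>, and integrating in
  \<open>t\<close> first leaves at most \<open>(1 + 1/s) V(u)\<^bsup>-s\<^esup> m(u) \<le> (1 + 1/s) k(u)\<close>.
\<close>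
lemma nn_integral_majorant_le:
  assumes [measurable]: "\<sigma> \<in> borel_measurable half_line" "k \<in> borel_measurable half_line"
    and fin: "\<And>x. 0 < x \<Longrightarrow> primitive \<sigma> x < \<infinity>" and "0 < s" "0 < b"
  defines "m \<equiv> \<lambda>t. k t * ennpowr (primitive \<sigma> t) s"
  shows "(\<integral>\<^sup>+ t. (m t * ennpowr (primitive \<sigma> t) b
      + ennpowr (primitive \<sigma> t) (b - 1) * \<sigma> t * primitive m t) * ennpowr (primitive \<sigma> t) (- s - b) \<partial>half_line)
    \<le> ennreal (2 + 1 / s) * (\<integral>\<^sup>+ t. k t \<partial>half_line)"
proof -
  define V where "V = primitive \<sigma>"
  have [measurable]: "V \<in> borel_measurable half_line" unfolding V_def by measurable
  have [measurable]: "m \<in> borel_measurable half_line" unfolding m_def by measurable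
  have cancel: "ennpowr (V t) s * ennpowr (V t) (- s) \<le> 1" if "0 < t" for t
    using ennpowr_add[of "V t" s "- s"] fin[OF that] \<open>0 < s\<close>
    by (cases "V t = 0") (auto simp: V_def ennpowr_0_left zero_less_iff_neq_zero)
  have "(\<integral>\<^sup>+ t. (m t * ennpowr (V t) b + ennpowr (V t) (b - 1) * \<sigma> t * primitive m t) * ennpowr (V t) (- s - b) \<partial>half_line)
    \<le> (\<integral>\<^sup>+ t. k t + ennpowr (V t) (- (1 + s)) * \<sigma> t * primitive m t \<partial>half_line)"
  proof (rule nn_integral_mono_AE)
    show "AE t in half_line. (m t * ennpowr (V t) b + ennpowr (V t) (b - 1) * \<sigma> t * primitive m t) * ennpowr (V t) (- s - b)
      \<le> k t + ennpowr (V t) (- (1 + s)) * \<sigma> t * primitive m t"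
      using AE_half_line_pos AE_primitive_eq_0[OF assms(1)]
    proof eventually_elim
      case (elim t)
      show ?case
      proof (cases "V t = 0")
        case True
        then show ?thesis using elim \<open>0 < s\<close> \<open>0 < b\<close> by (simp add: V_def m_def ennpowr_0_left)
      next
        case False
        then have Vt: "0 < V t \<and> V t < \<infinity>"
          using fin[OF elim(1)] by (simp add: V_def zero_less_iff_neq_zero)
        have "ennpowr (V t) b * ennpowr (V t) (- s - b) = ennpowr (V t) (- s)"
          using ennpowr_add[of "V t" b "- s - b"] Vt by simp
        then have 1: "m t * ennpowr (V t) b * ennpowr (V t) (- s - b)
            = k t * (ennpowr (V t) s * ennpowr (V t) (- s))"
          by (simp add: m_def V_def mult.assoc)
        have 2: "ennpowr (V t) (b - 1) * ennpowr (V t) (- s - b) = ennpowr (V t) (- (1 + s))"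
          using ennpowr_add[of "V t" "b - 1" "- s - b"] Vt by simp
        have "(m t * ennpowr (V t) b + ennpowr (V t) (b - 1) * \<sigma> t * primitive m t) * ennpowr (V t) (- s - b)
          = k t * (ennpowr (V t) s * ennpowr (V t) (- s)) + ennpowr (V t) (- (1 + s)) * \<sigma> t * primitive m t"
          unfolding distrib_right 1 2[symmetric] by (simp add: mult_ac)
        then show ?thesis using mult_left_mono[OF cancel[OF elim(1)], of "k t"]
          by (simp add: add_right_mono)
      qed
    qed
  qed
  also have "\<dots> = (\<integral>\<^sup>+ t. k t \<partial>half_line)
      + (\<integral>\<^sup>+ t. ennpowr (V t) (- (1 + s)) * \<sigma> t * primitive m t \<partial>half_line)"
    by (rule nn_integral_add) measurable
  also have "(\<integral>\<^sup>+ t. ennpowr (V t) (- (1 + s)) * \<sigma> t * primitive m t \<partial>half_line)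
     = (\<integral>\<^sup>+ t. \<integral>\<^sup>+ u. ennpowr (V t) (- (1 + s)) * \<sigma> t * (m u * (if u < t then 1 else 0)) \<partial>half_line \<partial>half_line)"
  proof (rule nn_integral_cong)
    fix t
    have "primitive m t = (\<integral>\<^sup>+ u. m u * (if u < t then 1 else 0) \<partial>half_line)"
      unfolding primitive_eq_half_line by (intro nn_integral_cong) (auto simp: indicator_def)
    then show "ennpowr (V t) (- (1 + s)) * \<sigma> t * primitive m t
      = (\<integral>\<^sup>+ u. ennpowr (V t) (- (1 + s)) * \<sigma> t * (m u * (if u < t then 1 else 0)) \<partial>half_line)"
      by (simp add: nn_integral_cmult)
  qed
  also have "\<dots> = (\<integral>\<^sup>+ u. \<integral>\<^sup>+ t. ennpowr (V t) (- (1 + s)) * \<sigma> t * (m u * (if u < t then 1 else 0)) \<partial>half_line \<partial>half_line)"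
    by (rule Fubini_half_line) measurable
  also have "\<dots> \<le> (\<integral>\<^sup>+ u. ennreal (1 + 1 / s) * k u \<partial>half_line)"
  proof (rule nn_integral_mono)
    fix u assume "u \<in> space half_line"
    then have "0 < u" by (simp add: space_restrict_space)
    show "(\<integral>\<^sup>+ t. ennpowr (V t) (- (1 + s)) * \<sigma> t * (m u * (if u < t then 1 else 0)) \<partial>half_line)
      \<le> ennreal (1 + 1 / s) * k u"
    proof (cases "V u = 0")
      case True
      then show ?thesis using \<open>0 < s\<close> by (simp add: m_def V_def ennpowr_0_left)
    next
      case False
      then have Vu: "0 < V u" "V u < \<infinity>"
        using fin[OF \<open>0 < u\<close>] by (auto simp: V_def zero_less_iff_neq_zero)
      have "(\<integral>\<^sup>+ t. ennpowr (V t) (- (1 + s)) * \<sigma> t * (m u * (if u < t then 1 else 0)) \<partial>half_line)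
        \<le> (\<integral>\<^sup>+ t. m u * (ennpowr (max (V t) (V u)) (- (1 + s)) * \<sigma> t) \<partial>half_line)"
        using primitive_mono[of u _ \<sigma>]
        by (intro nn_integral_mono) (auto simp: V_def max_absorb1 mult_ac)
      also have "\<dots> = m u * (\<integral>\<^sup>+ t. ennpowr (max (V t) (V u)) (- (1 + s)) * \<sigma> t \<partial>half_line)"
        by (rule nn_integral_cmult) measurable
      also have "\<dots> \<le> m u * (ennreal ((1 + s) / (1 + s - 1)) * ennpowr (V u) (1 - (1 + s)))"
        using nn_integral_max_powr_primitive_le[OF assms(1) Vu, of "1 + s"] \<open>0 < s\<close>
        by (intro mult_left_mono) (auto simp: V_def)
      also have "\<dots> = ennreal (1 + 1 / s) * (k u * (ennpowr (V u) s * ennpowr (V u) (- s)))"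
        using \<open>0 < s\<close> by (simp add: m_def V_def mult_ac add_divide_distrib add.commute)
      also have "\<dots> \<le> ennreal (1 + 1 / s) * (k u * 1)"
        by (intro mult_left_mono cancel[OF \<open>0 < u\<close>]) auto
      finally show ?thesis by simp
    qed
  qed
  also have "\<dots> = ennreal (1 + 1 / s) * (\<integral>\<^sup>+ u. k u \<partial>half_line)"
    by (rule nn_integral_cmult) measurable
  also have "(\<integral>\<^sup>+ t. k t \<partial>half_line) + \<dots> = ennreal (1 + (1 + 1 / s)) * (\<integral>\<^sup>+ t. k t \<partial>half_line)"
    using \<open>0 < s\<close> by (subst ennreal_plus) (auto simp: distrib_right)
  finally show ?thesis by (simp add: V_def add_left_mono)
qed

text \<open>
  Hoelder's inequality for \<open>h = (h v\<^bsup>1/p\<^esup> V\<^sup>e) (v\<^bsup>-1/p\<^esup> V\<^bsup>-e\<^esup>)\<close> on \<open>(0,x)\<close>, with \<open>e = (p - 1)\<^sup>2 / p\<^sup>2\<close>.  The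
  \<open>p'\<close>-th power of the second factor is \<open>V\<^bsup>-ep'\<^esup> \<sigma>\<close>.  Any \<open>e\<close> with \<open>0 < e p' < 1\<close> bounds its
  integral by a power of \<open>V(x)\<close>.  The resulting exponent
  \<open>b = p - 1 - ep\<close> has to lie in \<open>(0,1]\<close> for the product rule estimate above; the choice made here gives
  \<open>e p' = b = (p - 1) / p\<close>.
\<close>
lemma powr_primitive_le_weighted:
  fixes v h :: "real \<Rightarrow> ennreal" and p :: real
  defines "\<sigma> \<equiv> \<lambda>t. ennpowr (v t) (1 - conj_exponent p)"
  assumes [measurable]: "v \<in> borel_measurable half_line" "h \<in> borel_measurable half_line"
    and v_pos: "AE t in half_line. 0 < v t" and "1 < p"
    and fin: "\<And>x. 0 < x \<Longrightarrow> primitive \<sigma> x < \<infinity>"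
    and finite_norm: "(\<integral>\<^sup>+ t. ennpowr (h t) p * v t \<partial>half_line) < \<infinity>"
    and "0 < x"
  shows "ennpowr (primitive h x) p \<le> ennreal (p powr (p - 1)) *
    (ennpowr (primitive \<sigma> x) ((p - 1) / p) *
      primitive (\<lambda>t. ennpowr (h t) p * v t * ennpowr (primitive \<sigma> t) ((p - 1)\<^sup>2 / p)) x)"
proof -
  define V where "V = primitive \<sigma>"
  have [measurable]: "\<sigma> \<in> borel_measurable half_line" unfolding \<sigma>_def by measurable
  have [measurable]: "V \<in> borel_measurable half_line" unfolding V_def by measurable
  define q where "q = conj_exponent p"
  define e where "e = (p - 1)\<^sup>2 / p / p"
  have e_pos: "0 < e" using \<open>1 < p\<close> by (simp add: e_def)
  have q: "q = p / (p - 1)" "0 < q" and e: "e * p = (p - 1)\<^sup>2 / p" "e * q = (p - 1) / p"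
    using \<open>1 < p\<close> by (auto simp: q_def conj_exponent_def e_def power2_eq_square field_simps)
  \<comment> \<open>Cancelling the powers of \<open>v\<close> and \<open>V\<close> needs both to be positive and finite.  Where \<open>v = \<infinity>\<close>,
    finiteness of the norm gives \<open>h = 0\<close>; where \<open>V = 0\<close>, almost everywhere \<open>\<sigma> = 0\<close>, that is \<open>v = \<infinity>\<close>.\<close>
  have nontrivial: "AE t in half_line. h t \<noteq> 0 \<longrightarrow> 0 < v t \<and> v t < \<infinity> \<and> 0 < V t \<and> V t < \<infinity>"
  proof -
    have "AE t in half_line. ennpowr (h t) p * v t \<noteq> \<infinity>"
      using finite_norm by (intro nn_integral_noteq_infinite) auto
    then show ?thesis
      using v_pos AE_primitive_eq_0[OF \<open>\<sigma> \<in> borel_measurable half_line\<close>] AE_half_line_pos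
    proof eventually_elim
      case (elim t)
      show ?case
      proof
        assume "h t \<noteq> 0"
        then have "ennpowr (h t) p \<noteq> 0" using \<open>1 < p\<close>
          by (cases "h t" rule: ennreal_0_pos_top_cases) (auto simp: ennpowr_ennreal ennpowr_top_left)
        with elim have v: "v t < \<infinity>" by (auto simp: ennreal_mult_eq_top_iff less_top)
        with elim have "\<sigma> t \<noteq> 0"
          using ennpowr_pos_finite(1)[of "v t" "1 - conj_exponent p"] by (auto simp: \<sigma>_def)
        with elim fin[of t] v show "0 < v t \<and> v t < \<infinity> \<and> 0 < V t \<and> V t < \<infinity>"
          by (auto simp: V_def zero_less_iff_neq_zero)
      qed
    qed
  qed
  define f where "f t = h t * ennpowr (v t) (1 / p) * ennpowr (V t) e * indicator {..<x} t" for t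
  define g where "g t = ennpowr (v t) (- 1 / p) * ennpowr (V t) (- e) * indicator {..<x} t" for t
  have [measurable]: "f \<in> borel_measurable half_line" "g \<in> borel_measurable half_line"
    unfolding f_def g_def by measurable
  have f_powr: "ennpowr (f t) p = ennpowr (h t) p * v t * ennpowr (V t) ((p - 1)\<^sup>2 / p) * indicator {..<x} t" for t
    using \<open>1 < p\<close> by (simp add: f_def ennpowr_indicator ennpowr_mult ennpowr_ennpowr e)
  have g_powr: "ennpowr (g t) q = ennpowr (V t) (- ((p - 1) / p)) * \<sigma> t * indicator {..<x} t" for t
  proof -
    have "- 1 / p * q = 1 - conj_exponent p"
      using \<open>1 < p\<close> by (simp add: q conj_exponent_def field_simps)
    then show ?thesis using q e e_pos
      by (simp add: g_def ennpowr_indicator ennpowr_mult ennpowr_ennpowr \<sigma>_def mult_ac)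
  qed
  have "primitive h x = (\<integral>\<^sup>+ t. f t * g t \<partial>half_line)"
    unfolding primitive_eq_half_line
  proof (rule nn_integral_cong_AE)
    show "AE t in half_line. h t * indicator {..<x} t = f t * g t"
      using nontrivial
    proof eventually_elim
      case (elim t)
      show ?case
      proof (cases "h t = 0")
        case False
        with elim have "ennpowr (v t) (1 / p) * ennpowr (v t) (- 1 / p) = 1"
          "ennpowr (V t) e * ennpowr (V t) (- e) = 1"
          using ennpowr_add[of "v t" "1 / p" "- 1 / p"] ennpowr_add[of "V t" e "- e"] by auto
        moreover have "f t * g t = h t * (ennpowr (v t) (1 / p) * ennpowr (v t) (- 1 / p))
            * (ennpowr (V t) e * ennpowr (V t) (- e)) * (indicator {..<x} t * indicator {..<x} t)"
          by (simp only: f_def g_def mult_ac)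
        ultimately show ?thesis by (simp add: indicator_def)
      qed (simp add: f_def)
    qed
  qed
  also have "\<dots> \<le> ennpowr (\<integral>\<^sup>+ t. ennpowr (f t) p \<partial>half_line) (1 / p)
      * ennpowr (\<integral>\<^sup>+ t. ennpowr (g t) q \<partial>half_line) (1 / q)"
    unfolding q_def by (rule nn_integral_Hoelder) (use \<open>1 < p\<close> in auto)
  also have "(\<integral>\<^sup>+ t. ennpowr (f t) p \<partial>half_line)
      = primitive (\<lambda>t. ennpowr (h t) p * v t * ennpowr (V t) ((p - 1)\<^sup>2 / p)) x" (is "_ = ?K")
    by (simp add: f_powr primitive_eq_half_line)
  also have "(\<integral>\<^sup>+ t. ennpowr (g t) q \<partial>half_line)
      = primitive (\<lambda>t. ennpowr (V t) (- ((p - 1) / p)) * \<sigma> t) x" (is "_ = ?B")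
    by (simp add: g_powr primitive_eq_half_line)
  finally have "ennpowr (primitive h x) p \<le> ennpowr (ennpowr ?K (1 / p) * ennpowr ?B (1 / q)) p"
    using \<open>1 < p\<close> by (intro ennpowr_mono) auto
  also have "\<dots> = ?K * ennpowr ?B (p - 1)"
    using \<open>1 < p\<close> by (simp add: ennpowr_mult ennpowr_ennpowr q)
  also have "?B \<le> ennreal p * ennpowr (V x) (1 / p)"
  proof -
    have "1 - (p - 1) / p = 1 / p" using \<open>1 < p\<close> by (simp add: field_simps)
    then show ?thesis
      using primitive_powr_primitive_le[of \<sigma> x "(p - 1) / p"] fin[OF \<open>0 < x\<close>] \<open>1 < p\<close>
      by (simp add: V_def)
  qed
  then have "?K * ennpowr ?B (p - 1) \<le> ?K * ennpowr (ennreal p * ennpowr (V x) (1 / p)) (p - 1)"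
    using \<open>1 < p\<close> by (intro mult_left_mono ennpowr_mono) auto
  also have "\<dots> = ennreal (p powr (p - 1)) * (ennpowr (V x) ((p - 1) / p) * ?K)"
    using \<open>1 < p\<close> by (simp add: ennpowr_mult ennpowr_ennpowr ennpowr_ennreal mult_ac)
  finally show ?thesis by (simp add: V_def)
qed

text \<open>
  The exponents satisfy \<open>b + s = p - 1\<close>, so that the weight \<open>V\<^bsup>1-p\<^esup>\<close> is the one for which the majorant
  from the product rule has a norm bounded by that of \<open>h\<close>.
\<close>
lemma ex_powr_primitive_ge:
  fixes v h :: "real \<Rightarrow> ennreal" and p :: real
  defines "\<sigma> \<equiv> \<lambda>t. ennpowr (v t) (1 - conj_exponent p)"
  assumes [measurable]: "v \<in> borel_measurable half_line" "h \<in> borel_measurable half_line"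
    and v_pos: "AE t in half_line. 0 < v t" and "1 < p"
    and fin: "\<And>x. 0 < x \<Longrightarrow> primitive \<sigma> x < \<infinity>"
    and finite_norm: "(\<integral>\<^sup>+ t. ennpowr (h t) p * v t \<partial>half_line) < \<infinity>"
  obtains g where "g \<in> borel_measurable half_line"
    and "\<And>x. 0 < x \<Longrightarrow> primitive h x \<le> ennpowr (primitive g x) (1 / p)"
    and "(\<integral>\<^sup>+ t. g t * ennpowr (primitive \<sigma> t) (1 - p) \<partial>half_line) \<le>
      ennreal (p powr (p - 1) * (2 + p / (p - 1)\<^sup>2)) * (\<integral>\<^sup>+ t. ennpowr (h t) p * v t \<partial>half_line)"
proof
  define V where "V = primitive \<sigma>"
  define b s where "b = (p - 1) / p" and "s = (p - 1)\<^sup>2 / p"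
  have s: "0 < s" using \<open>1 < p\<close> by (simp add: s_def)
  have b: "0 < b" "b \<le> 1" and sb: "- s - b = 1 - p"
    using \<open>1 < p\<close> by (auto simp: b_def s_def field_simps power2_eq_square)
  define k where "k t = ennpowr (h t) p * v t" for t
  define m where "m t = k t * ennpowr (V t) s" for t
  define g\<^sub>0 where "g\<^sub>0 t = m t * ennpowr (V t) b + ennpowr (V t) (b - 1) * \<sigma> t * primitive m t" for t
  have [measurable]: "\<sigma> \<in> borel_measurable half_line" unfolding \<sigma>_def by measurable
  have [measurable]: "V \<in> borel_measurable half_line" unfolding V_def by measurable
  have [measurable]: "k \<in> borel_measurable half_line" unfolding k_def by measurable
  have [measurable]: "m \<in> borel_measurable half_line" unfolding m_def by measurable
  have [measurable]: "g\<^sub>0 \<in> borel_measurable half_line" unfolding g\<^sub>0_def by measurable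
  define g where "g t = ennreal (p powr (p - 1)) * g\<^sub>0 t" for t
  show "g \<in> borel_measurable half_line" unfolding g_def by measurable
  show "primitive h x \<le> ennpowr (primitive g x) (1 / p)" if "0 < x" for x
  proof -
    have "ennpowr (primitive h x) p \<le> ennreal (p powr (p - 1)) * (ennpowr (V x) b * primitive m x)"
      using powr_primitive_le_weighted[of v h p x] assms \<open>0 < x\<close>
      unfolding m_def k_def V_def b_def s_def by simp
    also have "\<dots> \<le> ennreal (p powr (p - 1)) * primitive g\<^sub>0 x"
      unfolding g\<^sub>0_def V_def
      by (intro mult_left_mono powr_primitive_mult_primitive_le b fin \<open>0 < x\<close>) auto
    also have "\<dots> = primitive g x"
      by (simp add: g_def primitive_eq_half_line mult.assoc nn_integral_cmult)
    finally have "ennpowr (ennpowr (primitive h x) p) (1 / p) \<le> ennpowr (primitive g x) (1 / p)"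
      using \<open>1 < p\<close> by (intro ennpowr_mono) auto
    then show ?thesis using \<open>1 < p\<close> by (simp add: ennpowr_ennpowr)
  qed
  have "(\<integral>\<^sup>+ t. g t * ennpowr (V t) (1 - p) \<partial>half_line)
      = ennreal (p powr (p - 1)) * (\<integral>\<^sup>+ t. g\<^sub>0 t * ennpowr (V t) (- s - b) \<partial>half_line)"
    by (simp add: g_def sb mult.assoc nn_integral_cmult)
  also have "\<dots> \<le> ennreal (p powr (p - 1)) * (ennreal (2 + 1 / s) * (\<integral>\<^sup>+ t. k t \<partial>half_line))"
    unfolding g\<^sub>0_def m_def V_def by (intro mult_left_mono nn_integral_majorant_le fin s b) auto
  also have "\<dots> = ennreal (p powr (p - 1) * (2 + p / (p - 1)\<^sup>2)) * (\<integral>\<^sup>+ t. k t \<partial>half_line)"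
    using \<open>1 < p\<close> by (simp add: s_def ennreal_mult mult.assoc)
  finally show "(\<integral>\<^sup>+ t. g t * ennpowr (primitive \<sigma> t) (1 - p) \<partial>half_line) \<le>
      ennreal (p powr (p - 1) * (2 + p / (p - 1)\<^sup>2)) * (\<integral>\<^sup>+ t. ennpowr (h t) p * v t \<partial>half_line)"
    by (simp add: V_def k_def)
qed

section \<open>Equivalence of the two inequalities\<close>

text \<open>
  The exponents match because \<open>p p' = p + p'\<close>.  Through this identity \<open>\<integral> g\<^sup>p v\<close> becomes
  \<open>\<integral> \<sigma> G\<close> for \<open>g = \<sigma> G\<^bsup>1/p\<^esup>\<close>.
\<close>
lemma ennpowr_conj_exponent_mult:
  assumes "1 < p" "0 < z"
  shows "ennpowr (ennpowr z (1 - conj_exponent p)) p * z = ennpowr z (1 - conj_exponent p)"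
proof -
  have e: "(1 - conj_exponent p) * p + 1 = 1 - conj_exponent p" "1 - conj_exponent p < 0"
    using \<open>1 < p\<close> by (auto simp: conj_exponent_def field_simps)
  show ?thesis
  proof (cases "z = \<infinity>")
    case True
    then show ?thesis using e \<open>1 < p\<close> by (simp add: ennpowr_top_left ennpowr_0_left)
  next
    case False
    then have "ennpowr z ((1 - conj_exponent p) * p + 1) = ennpowr z ((1 - conj_exponent p) * p) * ennpowr z 1"
      using \<open>0 < z\<close> by (intro ennpowr_add) (simp add: less_top)
    then have "ennpowr z (1 - conj_exponent p) = ennpowr z ((1 - conj_exponent p) * p) * z"
      by (simp only: e(1) ennpowr_1)
    then show ?thesis unfolding ennpowr_ennpowr by (rule sym)
  qed
qed

lemma wnorm_mono_AE:
  assumes "0 < s" "AE x in half_line. f x \<le> g x"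
  shows "wnorm s \<omega> f \<le> wnorm s \<omega> g"
  unfolding wnorm_def using assms
  by (intro ennpowr_mono nn_integral_mono_AE) (auto intro!: mult_right_mono ennpowr_mono)

lemma wnorm_cmult:
  assumes "0 < s" and [measurable]: "f \<in> borel_measurable half_line" "\<omega> \<in> borel_measurable half_line"
  shows "wnorm s \<omega> (\<lambda>x. c * f x) = c * wnorm s \<omega> f"
  using \<open>0 < s\<close>
  by (simp add: wnorm_def ennpowr_mult mult.assoc nn_integral_cmult ennpowr_ennpowr)

lemma wnorm_powr:
  assumes "0 < p" "0 < q"
  shows "wnorm (q / p) \<omega> (\<lambda>x. ennpowr (f x) p) = ennpowr (wnorm q \<omega> f) p"
  using assms by (simp add: wnorm_def ennpowr_ennpowr)

text \<open>
  The operator enters through this estimate, which carries pointwise domination of the arguments over to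
  the norms of the images.
\<close>
lemma monotone_quasilinear_wnorm_mono:
  assumes "monotone_quasilinear T" "w \<in> weights" "0 < q"
  obtains c :: real where "0 < c"
    and "\<And>f g. f \<in> Mplus \<Longrightarrow> g \<in> Mplus \<Longrightarrow> (\<And>x. 0 < x \<Longrightarrow> f x \<le> g x) \<Longrightarrow>
      wnorm q w (T f) \<le> ennreal c * wnorm q w (T g)"
proof -
  from assms obtain c :: real where "0 < c" and c: "\<And>f g. f \<in> Mplus \<Longrightarrow> g \<in> Mplus \<Longrightarrow>
      (AE x in half_line. f x \<le> g x) \<Longrightarrow> AE x in half_line. T f x \<le> ennreal c * T g x"
    and T: "\<And>f. f \<in> Mplus \<Longrightarrow> T f \<in> Mplus"
    unfolding monotone_quasilinear_def by metis
  show thesis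
  proof (rule that[OF \<open>0 < c\<close>])
    fix f g assume fg: "f \<in> Mplus" "g \<in> Mplus" and le: "\<And>x. 0 < x \<Longrightarrow> f x \<le> g x"
    have "AE x in half_line. f x \<le> g x"
      using AE_half_line_pos by eventually_elim (rule le)
    from c[OF fg this] have "wnorm q w (T f) \<le> wnorm q w (\<lambda>x. ennreal c * T g x)"
      by (rule wnorm_mono_AE[OF \<open>0 < q\<close>])
    also have "\<dots> = ennreal c * wnorm q w (T g)"
      using T[OF fg(2)] \<open>w \<in> weights\<close> \<open>0 < q\<close> by (intro wnorm_cmult) (auto simp: Mplus_def weights_def)
    finally show "wnorm q w (T f) \<le> ennreal c * wnorm q w (T g)" .
  qed
qed

lemma Phi_powr:
  assumes "1 < p"
  shows "ennpowr (Phi p v x) (1 - 2 * p) = ennpowr (primitive (\<lambda>t. ennpowr (v t) (1 - conj_exponent p)) x) (1 - p)"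
proof -
  have "1 / (conj_exponent p + 1) * (1 - 2 * p) = 1 - p"
  proof -
    have "conj_exponent p + 1 = (2 * p - 1) / (p - 1)"
      using assms by (simp add: conj_exponent_def field_simps)
    then show ?thesis unfolding \<open>conj_exponent p + 1 = _\<close> using assms by (simp add: field_simps)
  qed
  then show ?thesis by (simp add: Phi_def ennpowr_ennpowr)
qed

theorem theorem1p5:
  fixes p q :: real
    and T :: "(real \<Rightarrow> ennreal) \<Rightarrow> (real \<Rightarrow> ennreal)"
    and v w :: "real \<Rightarrow> ennreal"
  assumes "0 < q" and "1 < p"
    and "monotone_quasilinear T"
    and "w \<in> weights" and "v \<in> weights"
    and "\<And>x. 0 < x \<Longrightarrow> primitive (\<lambda>t. ennpowr (v t) (1 - conj_exponent p)) x < \<infinity>"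
  shows
    "(\<exists>C::real. 0 < C \<and> (\<forall>h\<in>Mplus.
        wnorm q w (T (\<lambda>x. primitive h x)) \<le> ennreal C * wnorm p v h))
     \<longleftrightarrow>
     (\<exists>C::real. 0 < C \<and> (\<forall>h\<in>Mplus.
        wnorm (q / p) w (\<lambda>x. ennpowr (T (\<lambda>y. ennpowr (primitive h y) (1 / p)) x) p)
          \<le> ennreal (C powr p) * wnorm 1 (\<lambda>x. ennpowr (Phi p v x) (1 - 2 * p)) h))"
    (is "?hardy \<longleftrightarrow> ?reduced")
proof -
  define \<sigma> where "\<sigma> t = ennpowr (v t) (1 - conj_exponent p)" for t
  have [measurable]: "v \<in> borel_measurable half_line" and v_pos: "AE t in half_line. 0 < v t"
    using \<open>v \<in> weights\<close> by (auto simp: weights_def)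
  have [measurable]: "\<sigma> \<in> borel_measurable half_line" unfolding \<sigma>_def by measurable
  have fin: "primitive \<sigma> x < \<infinity>" if "0 < x" for x
    using assms(6)[OF that] by (simp add: \<sigma>_def[abs_def])
  have reduced_norm: "wnorm 1 (\<lambda>x. ennpowr (Phi p v x) (1 - 2 * p)) h
      = (\<integral>\<^sup>+ t. h t * ennpowr (primitive \<sigma> t) (1 - p) \<partial>half_line)" for h
    using \<open>1 < p\<close> by (simp add: wnorm_def Phi_powr \<sigma>_def[abs_def])
  have reduced_lhs: "wnorm (q / p) w (\<lambda>x. ennpowr (T f x) p) = ennpowr (wnorm q w (T f)) p" for f
    using \<open>1 < p\<close> \<open>0 < q\<close> by (intro wnorm_powr) auto
  have hardy_norm: "ennpowr (wnorm p v h) p = (\<integral>\<^sup>+ t. ennpowr (h t) p * v t \<partial>half_line)" for h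
    using \<open>1 < p\<close> by (simp add: wnorm_def ennpowr_ennpowr)
  have Mplus_primitive: "(\<lambda>x. ennpowr (primitive h x) a) \<in> Mplus" if "h \<in> Mplus" for h a
    using that unfolding Mplus_def by measurable
  obtain c where "0 < c" and c: "\<And>f g. f \<in> Mplus \<Longrightarrow> g \<in> Mplus \<Longrightarrow>
      (\<And>x. 0 < x \<Longrightarrow> f x \<le> g x) \<Longrightarrow> wnorm q w (T f) \<le> ennreal c * wnorm q w (T g)"
    using monotone_quasilinear_wnorm_mono[OF assms(3,4,1)] by blast
  show ?thesis
  proof
    assume ?hardy
    then obtain C where "0 < C"
      and C: "\<And>h. h \<in> Mplus \<Longrightarrow> wnorm q w (T (primitive h)) \<le> ennreal C * wnorm p v h"
      by auto
    define D where "D = c * C * (p / (p - 1)) powr (1 / p)"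
    have "0 < D" using \<open>0 < c\<close> \<open>0 < C\<close> \<open>1 < p\<close> by (simp add: D_def)
    have D_powr: "ennreal (D powr p) = ennpowr (ennreal c * ennreal C) p * ennreal (p / (p - 1))"
      using \<open>0 < c\<close> \<open>0 < C\<close> \<open>1 < p\<close>
      by (simp add: D_def powr_mult powr_powr ennpowr_ennreal flip: ennreal_mult')
    have "ennpowr (wnorm q w (T (\<lambda>y. ennpowr (primitive h y) (1 / p)))) p
        \<le> ennreal (D powr p) * (\<integral>\<^sup>+ t. h t * ennpowr (primitive \<sigma> t) (1 - p) \<partial>half_line)"
      (is "_ \<le> _ * ?N") if h: "h \<in> Mplus" for h
    proof (cases "?N = \<infinity>")
      case True
      then show ?thesis using \<open>0 < D\<close> by (simp add: ennreal_mult_top)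
    next
      case False
      then obtain G where [measurable]: "G \<in> borel_measurable half_line"
        and G_le: "\<And>x. 0 < x \<Longrightarrow>
          ennpowr (primitive h x) (1 / p) \<le> primitive (\<lambda>t. \<sigma> t * ennpowr (G t) (1 / p)) x"
        and G_norm: "(\<integral>\<^sup>+ t. \<sigma> t * G t \<partial>half_line) \<le> ennreal (p / (p - 1)) * ?N"
        using ex_primitive_ge_powr[of \<sigma> h p] h fin \<open>1 < p\<close> by (auto simp: less_top Mplus_def)
      define g where "g t = \<sigma> t * ennpowr (G t) (1 / p)" for t
      have g: "g \<in> Mplus" unfolding g_def Mplus_def by measurable
      have g_norm: "ennpowr (wnorm p v g) p = (\<integral>\<^sup>+ t. \<sigma> t * G t \<partial>half_line)"
        unfolding hardy_norm
      proof (rule nn_integral_cong_AE)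
        show "AE t in half_line. ennpowr (g t) p * v t = \<sigma> t * G t"
          using v_pos
        proof eventually_elim
          case (elim t)
          have "ennpowr (g t) p * v t = (ennpowr (\<sigma> t) p * v t) * G t"
            using \<open>1 < p\<close> by (simp add: g_def ennpowr_mult ennpowr_ennpowr mult_ac)
          then show ?case using ennpowr_conj_exponent_mult[OF \<open>1 < p\<close> elim] by (simp add: \<sigma>_def)
        qed
      qed
      have "wnorm q w (T (\<lambda>y. ennpowr (primitive h y) (1 / p))) \<le> ennreal c * wnorm q w (T (primitive g))"
        using c[OF Mplus_primitive[OF h] Mplus_primitive[OF g, of 1]] G_le by (simp add: g_def[abs_def])
      also have "\<dots> \<le> ennreal c * (ennreal C * wnorm p v g)"
        by (intro mult_left_mono C g) simp
      finally have "ennpowr (wnorm q w (T (\<lambda>y. ennpowr (primitive h y) (1 / p)))) p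
          \<le> ennpowr (ennreal c * ennreal C * wnorm p v g) p"
        using \<open>1 < p\<close> by (intro ennpowr_mono) (auto simp: mult.assoc)
      also have "\<dots> = ennpowr (ennreal c * ennreal C) p * (\<integral>\<^sup>+ t. \<sigma> t * G t \<partial>half_line)"
        using \<open>1 < p\<close> g_norm by (simp add: ennpowr_mult)
      also have "\<dots> \<le> ennpowr (ennreal c * ennreal C) p * (ennreal (p / (p - 1)) * ?N)"
        by (intro mult_left_mono G_norm) simp
      finally show ?thesis by (simp add: D_powr mult.assoc)
    qed
    then show ?reduced using \<open>0 < D\<close> unfolding reduced_lhs reduced_norm by blast
  next
    assume ?reduced
    then obtain C where "0 < C" and C: "\<And>h. h \<in> Mplus \<Longrightarrow>
        ennpowr (wnorm q w (T (\<lambda>y. ennpowr (primitive h y) (1 / p)))) p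
        \<le> ennreal (C powr p) * (\<integral>\<^sup>+ t. h t * ennpowr (primitive \<sigma> t) (1 - p) \<partial>half_line)"
      unfolding reduced_lhs reduced_norm by blast
    define K where "K = p powr (p - 1) * (2 + p / (p - 1)\<^sup>2)"
    define D where "D = c * C * K powr (1 / p)"
    have "0 < K" using \<open>1 < p\<close> by (auto simp: K_def intro!: mult_pos_pos add_pos_nonneg)
    then have "0 < D" using \<open>0 < c\<close> \<open>0 < C\<close> by (simp add: D_def)
    have D_powr: "ennpowr (ennreal D) p = ennpowr (ennreal c) p * (ennreal (C powr p) * ennreal K)"
      using \<open>0 < c\<close> \<open>0 < C\<close> \<open>0 < K\<close> \<open>1 < p\<close>
      by (simp add: D_def powr_mult powr_powr ennpowr_ennreal mult.assoc flip: ennreal_mult')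
    have "wnorm q w (T (primitive h)) \<le> ennreal D * wnorm p v h" if h: "h \<in> Mplus" for h
    proof (cases "wnorm p v h = \<infinity>")
      case True
      then show ?thesis using \<open>0 < D\<close> by (simp add: ennreal_mult_top)
    next
      case False
      then have "(\<integral>\<^sup>+ t. ennpowr (h t) p * v t \<partial>half_line) < \<infinity>"
        using \<open>1 < p\<close>
        by (cases "(\<integral>\<^sup>+ t. ennpowr (h t) p * v t \<partial>half_line) = \<infinity>")
          (auto simp: wnorm_def ennpowr_top_left less_top)
      then obtain g where [measurable]: "g \<in> borel_measurable half_line"
        and g_le: "\<And>x. 0 < x \<Longrightarrow> primitive h x \<le> ennpowr (primitive g x) (1 / p)"
        and g_norm: "(\<integral>\<^sup>+ t. g t * ennpowr (primitive \<sigma> t) (1 - p) \<partial>half_line)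
          \<le> ennreal K * ennpowr (wnorm p v h) p"
        using ex_powr_primitive_ge[of v h p] h fin v_pos \<open>1 < p\<close>
        by (auto simp: Mplus_def K_def hardy_norm \<sigma>_def[abs_def])
      have g: "g \<in> Mplus" unfolding Mplus_def by measurable
      have "wnorm q w (T (primitive h)) \<le> ennreal c * wnorm q w (T (\<lambda>y. ennpowr (primitive g y) (1 / p)))"
        using c[OF Mplus_primitive[OF h, of 1] Mplus_primitive[OF g] ] g_le by simp
      then have "ennpowr (wnorm q w (T (primitive h))) p
          \<le> ennpowr (ennreal c * wnorm q w (T (\<lambda>y. ennpowr (primitive g y) (1 / p)))) p"
        using \<open>1 < p\<close> by (intro ennpowr_mono) auto
      also have "\<dots> = ennpowr (ennreal c) p * ennpowr (wnorm q w (T (\<lambda>y. ennpowr (primitive g y) (1 / p)))) p"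
        using \<open>1 < p\<close> by (simp add: ennpowr_mult)
      also have "\<dots> \<le> ennpowr (ennreal c) p * (ennreal (C powr p) * (ennreal K * ennpowr (wnorm p v h) p))"
        by (intro mult_left_mono order_trans[OF C[OF g]] g_norm) simp_all
      also have "\<dots> = ennpowr (ennreal D * wnorm p v h) p"
        using \<open>1 < p\<close> by (simp add: ennpowr_mult D_powr mult.assoc)
      finally have "ennpowr (wnorm q w (T (primitive h))) p \<le> ennpowr (ennreal D * wnorm p v h) p" .
      from ennpowr_mono[OF _ this, of "1 / p"] show ?thesis
        using \<open>1 < p\<close> by (simp add: ennpowr_ennpowr)
    qed
    then show ?hardy using \<open>0 < D\<close> by blast
  qed
qed

end
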